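(* The BestFirst heuristic has approximation factor $\Omega(\sqrt[3]{n})$ for each of Weighted-$1$-WiggleMin, $1$-WiggleMin, and Min-$\sum$|Prefixsum|; that is, for each of these problems there is a constant $c>0$ and instances of arbitrarily large size $n$ on which the value of the solution returned by BestFirst is at least $c\sqrt[3]{n}$ times the optimal value.
   Context: Min-$\sum$|Prefixsum|: given a multiset $S=\{s_1,\dots,s_n\}$ of reals, find a permutation (bijection $\pi:[n]\to S$) minimizing $\sum_{i=1}^n\left|\sum_{j=1}^i\pi(j)\right|$. An $\ell$-time series is a function $f:[\ell]\to\mathbb{R}_{\ge0}$. For a set $F=\{f_1,\dots,f_n\}$ of $\ell$-time series and a permutation $\pi:[n]\to F$, $W^\pi_{i,j}=\sum_{k=1}^i(\pi(k)(j+1)-\pi(k)(j))$. $1$-WiggleMin: minimize $\sum_{i=1}^n\sum_{j=1}^{\ell-1}|W^\pi_{i,j}|$. Weighted-$1$-WiggleMin: minimize $\sum_{i=1}^n\sum_{j=1}^{\ell-1}\frac{\pi(i)(j)+\pi(i)(j+1)+\pi(i+1)(j)+\pi(i+1)(j+1)}{4}|W^\pi_{i,j}|$, with $\pi(n+1)$ the identically zero series. BestFirst: starting from the empty order, for $i=1,\dots,n$ it extends the current partial order of length $i-1$ by appending, at the end, a not-yet-chosen element (number or time series) whose addition causes the smallest increase of the objective value of the partial order (for Min-$\sum$|Prefixsum| this increase is the absolute value of the new prefix sum). *)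

theory Defs
  imports Complex_Main "HOL-Library.FuncSet" "HOL-Combinatorics.Multiset_Permutations"
begin

text \<open>
  A permutation of an instance is a list enumerating its elements; positions in lists count from 0,
  so \<open>\<pi> ! i\<close> is what is usually written $\pi(i+1)$. The elements of an instance of
  Min-$\sum$|Prefixsum| form a multiset; those of a WiggleMin instance form a set. Objectives are
  defined on arbitrary lists, so they also give the value of a partial order.
\<close>

definition prefixsum_cost :: "real list \<Rightarrow> real" where
  "prefixsum_cost \<pi> = (\<Sum>i<length \<pi>. \<bar>\<Sum>j\<le>i. \<pi> ! j\<bar>)"

text \<open>
  Time points count from 1. Extensionality (\<open>\<rightarrow>\<^sub>E\<close>) makes two series equal exactly
  when they agree on \<open>{1..l}\<close>.
\<close>

definition time_series :: "nat \<Rightarrow> (nat \<Rightarrow> real) set" where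
  "time_series l = {1..l} \<rightarrow>\<^sub>E {0..}"

definition W :: "(nat \<Rightarrow> real) list \<Rightarrow> nat \<Rightarrow> nat \<Rightarrow> real" where
  "W \<pi> i j = (\<Sum>k\<le>i. (\<pi> ! k) (j + 1) - (\<pi> ! k) j)"

definition wiggle_cost :: "nat \<Rightarrow> (nat \<Rightarrow> real) list \<Rightarrow> real" where
  "wiggle_cost l \<pi> = (\<Sum>i<length \<pi>. \<Sum>j\<in>{1..<l}. \<bar>W \<pi> i j\<bar>)"

text \<open>
  The appended zero series is the successor of the last series of the (possibly partial) order.
\<close>

definition weighted_wiggle_cost :: "nat \<Rightarrow> (nat \<Rightarrow> real) list \<Rightarrow> real" where
  "weighted_wiggle_cost l \<pi> =
     (let \<rho> = \<pi> @ [\<lambda>_. 0] in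
      \<Sum>i<length \<pi>. \<Sum>j\<in>{1..<l}.
        ((\<rho> ! i) j + (\<rho> ! i) (j + 1) + (\<rho> ! Suc i) j + (\<rho> ! Suc i) (j + 1)) / 4 * \<bar>W \<pi> i j\<bar>)"

definition opt_value :: "('a list \<Rightarrow> real) \<Rightarrow> 'a multiset \<Rightarrow> real" where
  "opt_value cost S = Min (cost ` permutations_of_multiset S)"

text \<open>
  \<open>best_first_partial cost S xs\<close>: some way of breaking ties leads BestFirst to the partial
  order \<open>xs\<close>.
\<close>

inductive best_first_partial :: "('a list \<Rightarrow> real) \<Rightarrow> 'a multiset \<Rightarrow> 'a list \<Rightarrow> bool"
  for cost :: "'a list \<Rightarrow> real" and S :: "'a multiset" where
  empty: "best_first_partial cost S []"
| extend: "\<lbrakk>best_first_partial cost S xs; x \<in># S - mset xs;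
     \<forall>y \<in># S - mset xs. cost (xs @ [x]) - cost xs \<le> cost (xs @ [y]) - cost xs\<rbrakk>
   \<Longrightarrow> best_first_partial cost S (xs @ [x])"

definition best_first :: "('a list \<Rightarrow> real) \<Rightarrow> 'a multiset \<Rightarrow> 'a list \<Rightarrow> bool" where
  "best_first cost S \<pi> \<longleftrightarrow>
     best_first_partial cost S \<pi> \<and> \<pi> \<in> permutations_of_multiset S"

lemma best_first_exists: "\<exists>\<pi>. best_first cost S \<pi>"
proof -
  have "\<exists>xs. best_first_partial cost S xs \<and> mset xs \<subseteq># S \<and> length xs = k" if "k \<le> size S" for k
    using that
  proof (induction k)
    case 0
    show ?case by (rule exI[of _ "[]"]) (simp add: best_first_partial.empty)
  next
    case (Suc k)
    then obtain xs where xs: "best_first_partial cost S xs" "mset xs \<subseteq># S" "length xs = k"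
      by auto
    let ?R = "set_mset (S - mset xs)"
    let ?f = "\<lambda>y. cost (xs @ [y]) - cost xs"
    have "size (S - mset xs) > 0"
      using xs Suc.prems by (simp add: size_Diff_submset)
    then have ne: "?R \<noteq> {}" by auto
    then have "Min (?f ` ?R) \<in> ?f ` ?R" by (intro Min_in) auto
    then obtain x where x: "x \<in> ?R" "?f x = Min (?f ` ?R)" by force
    have "\<forall>y\<in>?R. ?f x \<le> ?f y" unfolding x(2) by simp
    then have "best_first_partial cost S (xs @ [x])"
      using xs(1) x(1) by (intro best_first_partial.extend) auto
    moreover have "mset (xs @ [x]) \<subseteq># S"
      using xs(2) x(1) by (metis add_mset_add_single insert_subset_eq_iff mset_append mset_single_iff
        mset_subset_eq_single subset_mset.le_diff_conv2 add.commute)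
    ultimately show ?case using xs(3) by (intro exI[of _ "xs @ [x]"]) auto
  qed
  from this[of "size S"] obtain xs where
    xs: "best_first_partial cost S xs" "mset xs \<subseteq># S" "length xs = size S" by auto
  then have "mset xs = S"
    by (metis mset_subset_size size_mset subset_mset.le_less less_irrefl)
  with xs(1) show ?thesis by (auto simp: best_first_def permutations_of_multiset_def)
qed

lemma prefixsum_cost_increase:
  "prefixsum_cost (xs @ [x]) - prefixsum_cost xs = \<bar>sum_list (xs @ [x])\<bar>"
proof -
  have "(\<Sum>j\<le>i. (xs @ [x]) ! j) = (\<Sum>j\<le>i. xs ! j)" if "i < length xs" for i
    using that by (intro sum.cong) (auto simp: nth_append)
  moreover have "(\<Sum>j\<le>length xs. (xs @ [x]) ! j) = sum_list (xs @ [x])"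
    by (simp only: sum_list_sum_nth) (simp add: atLeast0LessThan lessThan_Suc_atMost)
  ultimately show ?thesis by (simp add: prefixsum_cost_def)
qed

end

theory Submission imports Defs begin

text \<open>
  Consider $4h^2$ ones together with $2h$ copies each of $-2h$ and $2h - 2$. BestFirst raises the
  prefix sum to $h$ with ones and then cancels each $-2h$ against a $2h - 2$ at the price of only two
  ones. After all large numbers are gone, about $4h^2$ ones are left, which costs of order $h^4$.
  Paying each $-2h$ with $2h$ ones and putting the numbers $2h - 2$ last costs only of order $h^3$,
  so the ratio is of order $h$, that is, of order $\sqrt n$. With two time points,
  $1$-WiggleMin is Min-$\sum$|Prefixsum| for the slopes, and adding a huge constant to all series
  makes the weights nearly equal, so that the weighted problem behaves in the same way.
\<close>

section \<open>Partial orders of BestFirst and costs of prefix sums\<close>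

lemma best_first_partial_subset_mset:
  "best_first_partial cost S xs \<Longrightarrow> mset xs \<subseteq># S"
proof (induction rule: best_first_partial.induct)
  case empty
  show ?case by simp
next
  case (extend xs x)
  then show ?case
    by (metis add_mset_add_single insert_subset_eq_iff mset_append mset_single_iff
        mset_subset_eq_single subset_mset.le_diff_conv2 add.commute)
qed

lemma prefixsum_cost_Nil [simp]: "prefixsum_cost [] = 0"
  by (simp add: prefixsum_cost_def)

lemma prefixsum_cost_snoc:
  "prefixsum_cost (xs @ [x]) = prefixsum_cost xs + \<bar>sum_list xs + x\<bar>"
  using prefixsum_cost_increase[of xs x] by simp

lemma prefixsum_cost_nonneg: "prefixsum_cost xs \<ge> 0"
  by (simp add: prefixsum_cost_def sum_nonneg)

lemma abs_sum_list_le_prefixsum_cost: "\<bar>sum_list xs\<bar> \<le> prefixsum_cost xs"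
proof (cases xs rule: rev_cases)
  case (snoc ys y)
  then show ?thesis using prefixsum_cost_nonneg[of ys] by (simp add: prefixsum_cost_snoc)
qed simp

lemma prefixsum_cost_append_replicate_le:
  assumes "\<And>i. 1 \<le> i \<Longrightarrow> i \<le> j \<Longrightarrow> \<bar>sum_list xs + real i * x\<bar> \<le> M"
  shows "prefixsum_cost (xs @ replicate j x) \<le> prefixsum_cost xs + real j * M"
  using assms
proof (induction j)
  case (Suc j)
  have eq: "xs @ replicate (Suc j) x = (xs @ replicate j x) @ [x]"
    by (simp add: replicate_append_same)
  have "\<bar>sum_list xs + real (Suc j) * x\<bar> \<le> M"
    by (rule Suc.prems) auto
  moreover have "prefixsum_cost (xs @ replicate j x) \<le> prefixsum_cost xs + real j * M"
    by (rule Suc.IH) (use Suc.prems in auto)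
  ultimately show ?case
    unfolding eq prefixsum_cost_snoc by (simp add: sum_list_replicate algebra_simps)
qed simp

section \<open>The hard multiset: the run of BestFirst on it and a cheap order\<close>

text \<open>The two large values add up to \<open>-2\<close>, so two ones pay for a pair of them.
  The number of ones is \<open>2 * h\<close> times \<open>2 * h\<close>, exactly enough to cancel
  every copy of \<open>-2h\<close> by ones alone.\<close>

definition bad_instance :: "nat \<Rightarrow> real multiset" where
  "bad_instance h = replicate_mset (2 * h) (- (2 * real h)) + replicate_mset (4 * h\<^sup>2) 1 +
     replicate_mset (2 * h) (2 * real h - 2)"

lemma size_bad_instance: "size (bad_instance h) = 4 * h\<^sup>2 + 4 * h"
  by (simp add: bad_instance_def)

lemma sum_mset_bad_instance: "sum_mset (bad_instance h) = 4 * (real h)\<^sup>2 - 4 * real h"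
  by (simp add: bad_instance_def algebra_simps power2_eq_square)

lemma bad_instance_memberD:
  assumes "x \<in># bad_instance h"
  shows "x = - (2 * real h) \<or> x = 1 \<or> x = 2 * real h - 2"
  using assms by (auto simp: bad_instance_def in_replicate_mset split: if_splits)

lemma sum_list_by_counts:
  assumes "mset xs \<subseteq># bad_instance h" "h \<ge> 2"
  shows "sum_list xs = real (count (mset xs) 1)
     + real (count (mset xs) (2 * real h - 2)) * (2 * real h - 2)
     - real (count (mset xs) (- (2 * real h))) * (2 * real h)"
  using assms(1)
proof (induction xs)
  case (Cons x xs)
  have neq: "2 * real h - 2 \<noteq> 1"
  proof
    assume "2 * real h - 2 = 1"
    then have "real (2 * h) = real 3" by simp
    then have "2 * h = 3" by (simp only: of_nat_eq_iff)
    then show False by presburger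
  qed
  have "x \<in># bad_instance h"
    using mset_subset_eqD[OF Cons.prems, of x] by simp
  moreover have "mset xs \<subseteq># bad_instance h"
    using Cons.prems by (rule subset_mset.order_trans[rotated]) simp
  ultimately show ?case
    using bad_instance_memberD Cons.IH neq assms(2) by (auto simp: algebra_simps)
qed simp

text \<open>
  As long as a \<open>-2h\<close> is left, BestFirst cycles through \<open>1, 1, -2h, 2h - 2\<close>, with prefix sums
  \<open>h - 1, h, -h, h - 2\<close>. With \<open>w\<close> ones used, a one is only appended at a prefix sum of at
  least \<open>w - 4h\<close>; summing this over all used ones gives the cost bound.
\<close>
lemma best_first_bad_instance_invariant:
  assumes "best_first_partial prefixsum_cost (bad_instance h) xs" and h: "h \<ge> 6"
  shows "let w = count (mset xs) 1; v = count (mset xs) (2 * real h - 2);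
             u = count (mset xs) (- (2 * real h)) in
    (u = v \<and> 2 * u \<le> w \<and> (u < 2 * h \<longrightarrow> w \<le> 2 * u + h) \<or> u = Suc v \<and> w = 2 * v + h) \<and>
    prefixsum_cost xs \<ge> (real w)\<^sup>2 / 2 - 6 * real h * real w"
  using assms(1)
proof (induction rule: best_first_partial.induct)
  case empty
  show ?case by simp
next
  case (extend xs x)
  define c d where "c = - (2 * real h)" and "d = 2 * real h - 2"
  define w v u where "w = count (mset xs) 1" and "v = count (mset xs) d" and "u = count (mset xs) c"
  let ?S = "bad_instance h"
  have sub: "mset xs \<subseteq># ?S" and sub': "mset (xs @ [x]) \<subseteq># ?S"
    using best_first_partial_subset_mset[OF extend.hyps(1)]
      best_first_partial_subset_mset[OF best_first_partial.extend[OF extend.hyps]] by auto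
  have IH: "u = v \<and> 2 * u \<le> w \<and> (u < 2 * h \<longrightarrow> w \<le> 2 * u + h) \<or> u = Suc v \<and> w = 2 * v + h"
    "prefixsum_cost xs \<ge> (real w)\<^sup>2 / 2 - 6 * real h * real w"
    using extend.IH unfolding Let_def c_def[symmetric] d_def[symmetric]
      w_def[symmetric] v_def[symmetric] u_def[symmetric] by auto
  have neq: "c \<noteq> 1" "d \<noteq> 1" "c \<noteq> d" "d \<noteq> c" "1 \<noteq> c" "1 \<noteq> d" using h by (auto simp: c_def d_def)
  have cnt: "count ?S 1 = 4 * h\<^sup>2" "count ?S d = 2 * h" "count ?S c = 2 * h"
    using neq by (auto simp: bad_instance_def c_def[symmetric] d_def[symmetric])
  have le: "w \<le> 4 * h\<^sup>2" "v \<le> 2 * h" "u \<le> 2 * h"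
    using mset_subset_eq_count[OF sub, of 1] mset_subset_eq_count[OF sub, of d]
      mset_subset_eq_count[OF sub, of c] by (simp_all add: w_def u_def v_def cnt)
  have le': "count (mset (xs @ [x])) 1 \<le> 4 * h\<^sup>2" "count (mset (xs @ [x])) d \<le> 2 * h"
     "count (mset (xs @ [x])) c \<le> 2 * h"
    using mset_subset_eq_count[OF sub', of 1] mset_subset_eq_count[OF sub', of d]
      mset_subset_eq_count[OF sub', of c] by (simp_all only: cnt)
  define P where "P = sum_list xs"
  have P: "P = real w + real v * d + real u * c"
    using sum_list_by_counts[OF sub] h unfolding P_def w_def v_def u_def c_def d_def by simp
  have best: "\<bar>P + x\<bar> \<le> \<bar>P + y\<bar>" if "count (mset xs) y < count ?S y" for y
  proof -
    have "y \<in># ?S - mset xs" using that by (simp add: in_diff_count)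
    then show ?thesis using extend.hyps(3) by (auto simp: prefixsum_cost_snoc P_def)
  qed
  have hsq: "36 * h \<le> 6 * h\<^sup>2" using h by (simp add: power2_eq_square)
  have x: "x = c \<or> x = 1 \<or> x = d"
    using extend.hyps(2) bad_instance_memberD unfolding c_def d_def by (meson in_diffD)
  \<comment> \<open>In (A) every \<open>c\<close> placed so far has been answered by a
    \<open>d\<close> and a \<open>c\<close> is still left; in (B) no large number is left; in (C)
    the last \<open>c\<close> still waits for its \<open>d\<close>.\<close>
  consider (A) "u = v" "2 * u \<le> w" "w \<le> 2 * u + h" "u < 2 * h"
    | (B) "u = v" "2 * u \<le> w" "u = 2 * h" | (C) "u = Suc v" "w = 2 * v + h"
    using IH(1) le by force
  then have *: "x = 1 \<and> u = v \<and> (u < 2 * h \<longrightarrow> w < 2 * u + h)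
     \<or> x = c \<and> u = v \<and> w = 2 * v + h \<or> x = d \<and> u = Suc v \<and> w = 2 * v + h"
  proof cases
    case A
    have Pw: "P = real w - 2 * real u" using A(1) unfolding P c_def d_def by (simp add: algebra_simps)
    have P0: "0 \<le> P" "P \<le> real h" using A unfolding Pw by linarith+
    \<comment> \<open>Here \<open>w <= 2u + h < 5h\<close>, so a one is still available as a
      competitor.\<close>
    have "w < 4 * h\<^sup>2" using A h hsq by linarith
    then have b1: "\<bar>P + x\<bar> \<le> \<bar>P + 1\<bar>" using best[of 1] cnt w_def by simp
    have bc: "\<bar>P + x\<bar> \<le> \<bar>P + c\<bar>" using best[of c] cnt u_def A by simp
    have "x \<noteq> d" using b1 P0 h by (auto simp: d_def)
    \<comment> \<open>At prefix sum \<open>h\<close> a one would lead to \<open>h + 1\<close>, while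
      \<open>c\<close> leads to \<open>-h\<close>; hence ones stop at \<open>h\<close>.\<close>
    moreover have "w < 2 * u + h" if "x = 1"
      using bc P0 h A that unfolding c_def Pw by linarith
    moreover have "w = 2 * v + h" if "x = c"
    proof -
      \<comment> \<open>This gives only \<open>P \<ge> h - 1/2\<close>; passing to natural numbers
        improves it to \<open>P \<ge> h\<close>, so \<open>c\<close> is never chosen before the
        prefix sum reaches \<open>h\<close>.\<close>
      have "2 * real h - P \<le> P + 1" using b1 P0 that unfolding c_def by linarith
      then have "real (2 * h + 4 * u) \<le> real (2 * w + 1)" unfolding Pw by simp
      then have "2 * h + 4 * u \<le> 2 * w + 1" by (simp only: of_nat_le_iff)
      then show ?thesis using A by linarith
    qed
    ultimately show ?thesis using x A by auto
  next
    case B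
    have "x \<noteq> d" using le'(2) B neq by (auto simp: v_def)
    moreover have "x \<noteq> c" using le'(3) B neq by (auto simp: u_def)
    ultimately show ?thesis using x B by auto
  next
    case C
    \<comment> \<open>From \<open>-h\<close>, the element \<open>d\<close> leads to absolute value
      \<open>h - 2\<close>, against \<open>h - 1\<close> for a one and \<open>3h\<close> for another
      \<open>c\<close>.\<close>
    have Pw: "P = - real h" unfolding P c_def d_def C by (simp add: algebra_simps)
    have "v < 2 * h" using C le by simp
    then have "\<bar>P + x\<bar> \<le> \<bar>P + d\<bar>" using best[of d] cnt v_def by simp
    then have "x \<noteq> 1 \<and> x \<noteq> c" using h unfolding Pw c_def d_def by auto
    then show ?thesis using x C by auto
  qed
  then consider (1) "x = 1" "u = v" "u < 2 * h \<Longrightarrow> w < 2 * u + h"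
    | (2) "x = c" "u = v" "w = 2 * v + h" | (3) "x = d" "u = Suc v" "w = 2 * v + h"
    by blast
  then show ?case
  proof cases
    case 1
    have cnts: "count (mset (xs @ [x])) 1 = Suc w" "count (mset (xs @ [x])) d = v"
      "count (mset (xs @ [x])) c = u"
      using neq 1 by (auto simp: w_def v_def u_def)
    have Pw: "P = real w - 2 * real u" using 1 unfolding P c_def d_def by (simp add: algebra_simps)
    have "2 * u \<le> w" using IH(1) 1 by auto
    have "prefixsum_cost (xs @ [x]) \<ge> prefixsum_cost xs + (P + 1)"
      using 1 by (simp add: prefixsum_cost_snoc P_def)
    \<comment> \<open>The claimed bound grows by \<open>w + 1/2 - 6h\<close> when \<open>w\<close>
      increases by one, which is less than \<open>w - 4h + 1\<close>. In the other two cases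
      \<open>w\<close> is unchanged and the cost cannot decrease.\<close>
    moreover have "P + 1 \<ge> real w - 4 * real h + 1"
      using le(3) unfolding Pw by linarith
    ultimately have "prefixsum_cost (xs @ [x]) \<ge> (real (Suc w))\<^sup>2 / 2 - 6 * real h * real (Suc w)"
      using IH(2) by (simp add: power2_eq_square field_simps)
    then show ?thesis
      unfolding Let_def c_def[symmetric] d_def[symmetric] cnts using 1 \<open>2 * u \<le> w\<close> by auto
  next
    case 2
    have cnts: "count (mset (xs @ [x])) 1 = w" "count (mset (xs @ [x])) d = v"
      "count (mset (xs @ [x])) c = Suc u"
      using neq 2 by (auto simp: w_def v_def u_def)
    show ?thesis
      unfolding Let_def c_def[symmetric] d_def[symmetric] cnts using 2 IH(2)
      by (auto simp: prefixsum_cost_snoc)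
  next
    case 3
    have cnts: "count (mset (xs @ [x])) 1 = w" "count (mset (xs @ [x])) d = Suc v"
      "count (mset (xs @ [x])) c = u"
      using neq 3 by (auto simp: w_def v_def u_def)
    show ?thesis
      unfolding Let_def c_def[symmetric] d_def[symmetric] cnts using 3 IH(2) h
      by (auto simp: prefixsum_cost_snoc)
  qed
qed

text \<open>A complete order has used all \<open>4h^2\<close> ones, so the invariant gives
  \<open>8h^4 - 24h^3\<close>, which is at least \<open>4h^4\<close> because
  \<open>h \<ge> 6\<close>.\<close>

lemma best_first_bad_instance_cost_ge:
  assumes "best_first_partial prefixsum_cost (bad_instance h) xs" "mset xs = bad_instance h" "h \<ge> 6"
  shows "prefixsum_cost xs \<ge> 4 * real h ^ 4"
proof -
  have "- (2 * real h) \<noteq> 1" "2 * real h - 2 \<noteq> 1" using assms(3) by auto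
  then have "count (bad_instance h) 1 = 4 * h\<^sup>2"
    by (auto simp: bad_instance_def)
  then have "prefixsum_cost xs \<ge> (real (4 * h\<^sup>2))\<^sup>2 / 2 - 6 * real h * real (4 * h\<^sup>2)"
    using best_first_bad_instance_invariant[OF assms(1,3)] assms(2) by (simp add: Let_def)
  also have "(real (4 * h\<^sup>2))\<^sup>2 / 2 - 6 * real h * real (4 * h\<^sup>2) = 4 * real h ^ 4 + 4 * real h ^ 3 * (real h - 6)"
    by (simp add: power2_eq_square power3_eq_cube power4_eq_xxxx algebra_simps)
  finally have "prefixsum_cost xs \<ge> 4 * real h ^ 4 + 4 * real h ^ 3 * (real h - 6)" .
  moreover have "0 \<le> 4 * real h ^ 3 * (real h - 6)"
    using assms(3) by (intro mult_nonneg_nonneg) auto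
  ultimately show ?thesis by linarith
qed

text \<open>The cheap order pays each \<open>-2h\<close> with \<open>2h\<close> ones and puts the elements \<open>2h - 2\<close> last.\<close>
lemma bad_instance_cheap_order:
  assumes h: "h \<ge> 4"
  shows "\<exists>L. mset L = bad_instance h \<and> prefixsum_cost L \<le> 17 * real h ^ 3"
proof -
  \<comment> \<open>\<open>M\<close> bounds the cost of one block: \<open>-2h\<close> followed by
    \<open>2h\<close> ones makes \<open>2h + 1\<close> prefix sums of absolute value at most
    \<open>2h\<close>, and the block returns the prefix sum to 0.\<close>
  define M where "M = 2 * real h * (2 * real h + 1)"
  have blocks: "\<exists>L. mset L = replicate_mset k (- (2 * real h)) + replicate_mset (k * (2 * h)) 1 \<and>
       prefixsum_cost L \<le> real k * M" for k
  proof (induction k)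
    case 0
    show ?case by (rule exI[of _ "[]"]) simp
  next
    case (Suc k)
    then obtain L where L: "mset L = replicate_mset k (- (2 * real h)) + replicate_mset (k * (2 * h)) 1"
      "prefixsum_cost L \<le> real k * M" by blast
    define L' where "L' = (L @ [- (2 * real h)]) @ replicate (2 * h) 1"
    have s: "sum_list L = 0"
      unfolding sum_mset_sum_list[symmetric] L(1) by (simp add: algebra_simps)
    have "prefixsum_cost L' \<le> prefixsum_cost (L @ [- (2 * real h)]) + real (2 * h) * (2 * real h)"
      unfolding L'_def by (rule prefixsum_cost_append_replicate_le) (simp add: s)
    then have "prefixsum_cost L' \<le> real (Suc k) * M"
      using L(2) s by (simp add: prefixsum_cost_snoc M_def algebra_simps)
    moreover have "mset L' = replicate_mset (Suc k) (- (2 * real h)) + replicate_mset (Suc k * (2 * h)) 1"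
      by (intro multiset_eqI) (simp add: L'_def L(1))
    ultimately show ?case by blast
  qed
  obtain L where L: "mset L = replicate_mset (2 * h) (- (2 * real h)) + replicate_mset (2 * h * (2 * h)) 1"
      "prefixsum_cost L \<le> real (2 * h) * M" using blocks by blast
  define L' where "L' = L @ replicate (2 * h) (2 * real h - 2)"
  have s: "sum_list L = 0"
    unfolding sum_mset_sum_list[symmetric] L(1) by (simp add: algebra_simps)
  have "prefixsum_cost L' \<le> prefixsum_cost L + real (2 * h) * (4 * (real h)\<^sup>2)"
    unfolding L'_def
  proof (rule prefixsum_cost_append_replicate_le)
    fix i assume "1 \<le> i" "i \<le> 2 * h"
    then have "real i * (2 * real h - 2) \<le> real (2 * h) * (2 * real h)"
      using h by (intro mult_mono) auto
    moreover have "real i * (2 * real h - 2) \<ge> 0" using h by simp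
    ultimately show "\<bar>sum_list L + real i * (2 * real h - 2)\<bar> \<le> 4 * (real h)\<^sup>2"
      by (simp add: s power2_eq_square)
  qed
  also have "\<dots> \<le> real (2 * h) * M + 8 * real h ^ 3"
    using L(2) by (simp add: power2_eq_square power3_eq_cube)
  also have "\<dots> = 16 * real h ^ 3 + 4 * (real h)\<^sup>2"
    by (simp add: M_def power2_eq_square power3_eq_cube algebra_simps)
  \<comment> \<open>The lower-order term is absorbed by \<open>h \<ge> 4\<close>, which turns the
    constant 16 into 17.\<close>
  also have "4 * (real h)\<^sup>2 \<le> real h ^ 3"
    using h by (simp add: power2_eq_square power3_eq_cube mult_right_mono)
  finally have "prefixsum_cost L' \<le> 17 * real h ^ 3" by simp
  moreover have "mset L' = bad_instance h"
    by (simp add: L'_def L(1) bad_instance_def power2_eq_square)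
  ultimately show ?thesis by blast
qed

section \<open>Transfer of the ratio to other objectives\<close>

text \<open>Lifts the cheap order of the numbers to an order of elements that carry these numbers,
  such as time series with prescribed slopes.\<close>

lemma obtain_map_eq_of_image_mset:
  assumes "image_mset g S = mset L"
  obtains xs where "mset xs = S" "map g xs = L"
  using assms
proof (induction L arbitrary: S thesis)
  case Nil
  then show ?case by auto
next
  case (Cons y L)
  then obtain x S' where S': "S = add_mset x S'" "g x = y" "image_mset g S' = mset L"
    by (auto dest!: msed_map_invR)
  then obtain xs where "mset xs = S'" "map g xs = L" using Cons.IH by metis
  with S' Cons.prems(1)[of "x # xs"] show ?case by simp
qed

text \<open>Common core of the three problems. BestFirst pays at least
  \<open>4 * \<alpha> * h^4\<close>, the optimum is at most \<open>68 * \<alpha> * h^3\<close>, and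
  the cube root of the size is at most \<open>2h\<close>; the constant 34 balances these bounds. The
  factor 4 in \<open>upper\<close> leaves room for the weighted objective.\<close>

lemma best_first_ratio_transfer:
  fixes cost :: "'a list \<Rightarrow> real" and g :: "'a \<Rightarrow> real"
  assumes h: "h \<ge> 6" and S: "image_mset g S = bad_instance h" and \<alpha>: "\<alpha> > 0"
    and lower: "\<And>xs. mset xs = S \<Longrightarrow> \<alpha> * prefixsum_cost (map g xs) \<le> cost xs"
    and upper: "\<And>xs. mset xs = S \<Longrightarrow> cost xs \<le> 4 * \<alpha> * prefixsum_cost (map g xs)"
    and greedy: "\<And>xs. best_first_partial cost S xs \<Longrightarrow>
       best_first_partial prefixsum_cost (bad_instance h) (map g xs)"
  shows "0 < opt_value cost S"
    and "best_first cost S \<pi> \<Longrightarrow> cost \<pi> \<ge> 1 / 34 * root 3 (real (size S)) * opt_value cost S"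
proof -
  have perms: "finite (permutations_of_multiset S)" "permutations_of_multiset S \<noteq> {}"
    by (simp_all add: permutations_of_multiset_not_empty)
  have sz: "size S = 4 * h\<^sup>2 + 4 * h"
    using size_bad_instance S by (metis size_image_mset)
  show pos: "0 < opt_value cost S"
  proof -
    have "0 < cost xs" if "xs \<in> permutations_of_multiset S" for xs
    proof -
      have xs: "mset xs = S" using that by (simp add: permutations_of_multiset_def)
      \<comment> \<open>The last prefix sum is the same positive number in every order, so no order
        has cost 0.\<close>
      have "sum_list (map g xs) = 4 * (real h)\<^sup>2 - 4 * real h"
        by (metis sum_mset_bad_instance S xs mset_map sum_mset_sum_list)
      also have "\<dots> > 0" using h by (simp add: power2_eq_square)
      finally have "0 < prefixsum_cost (map g xs)"
        using abs_sum_list_le_prefixsum_cost[of "map g xs"] by linarith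
      then show ?thesis using lower[OF xs] \<alpha> by (smt (verit) mult_pos_pos)
    qed
    then show ?thesis using perms by (simp add: opt_value_def)
  qed
  obtain L where L: "mset L = bad_instance h" "prefixsum_cost L \<le> 17 * real h ^ 3"
    using bad_instance_cheap_order[of h] h by auto
  then obtain xs where xs: "mset xs = S" "map g xs = L"
    using obtain_map_eq_of_image_mset S by metis
  have "opt_value cost S \<le> cost xs"
    unfolding opt_value_def using xs perms by (intro Min_le) (auto simp: permutations_of_multiset_def)
  also have "\<dots> \<le> 4 * \<alpha> * (17 * real h ^ 3)"
    using upper[OF xs(1)] L(2) xs(2) \<alpha> by (smt (verit) mult_left_mono)
  finally have opt: "opt_value cost S \<le> 68 * \<alpha> * real h ^ 3" by simp
  \<comment> \<open>The size is only of order \<open>h^2\<close>; this crude bound suffices for the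
    cube root.\<close>
  have "size S \<le> (2 * h) ^ 3"
  proof -
    have "h \<le> h * h" "h * h \<le> h * (h * h)" using h by simp_all
    moreover have "(2 * h) ^ 3 = 8 * (h * (h * h))" by (simp add: power3_eq_cube)
    ultimately show ?thesis unfolding sz power2_eq_square by linarith
  qed
  then have "real (size S) \<le> (2 * real h) ^ 3"
    by (metis of_nat_le_iff of_nat_mult of_nat_numeral of_nat_power)
  then have "root 3 (real (size S)) \<le> root 3 ((2 * real h) ^ 3)" by simp
  also have "root 3 ((2 * real h) ^ 3) = 2 * real h" by (rule real_root_power_cancel) simp_all
  finally have rt: "root 3 (real (size S)) \<le> 2 * real h" .
  show "cost \<pi> \<ge> 1 / 34 * root 3 (real (size S)) * opt_value cost S" if "best_first cost S \<pi>"
  proof -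
    have \<pi>: "best_first_partial cost S \<pi>" "mset \<pi> = S"
      using that by (auto simp: best_first_def permutations_of_multiset_def)
    have "1 / 34 * root 3 (real (size S)) * opt_value cost S \<le> 1 / 34 * (2 * real h) * (68 * \<alpha> * real h ^ 3)"
      using rt opt pos by (intro mult_mono) auto
    also have "\<dots> = \<alpha> * (4 * real h ^ 4)" by (simp add: power3_eq_cube power4_eq_xxxx)
    also have "\<dots> \<le> \<alpha> * prefixsum_cost (map g \<pi>)"
      using best_first_bad_instance_cost_ge[OF greedy[OF \<pi>(1)] _ h] \<pi>(2) S \<alpha> by simp
    also have "\<dots> \<le> cost \<pi>" by (rule lower[OF \<pi>(2)])
    finally show ?thesis .
  qed
qed

text \<open>Reduces the simulation of a whole run to single choices. The elements left over after
  \<open>map g xs\<close> are exactly the images of those left over after \<open>xs\<close>, so a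
  best choice for \<open>cost\<close> is sent to a best choice for the prefix sums.\<close>

lemma best_first_partial_map:
  assumes "best_first_partial cost S xs"
    and step: "\<And>xs x y. mset xs \<subseteq># S \<Longrightarrow> x \<in># S - mset xs \<Longrightarrow> y \<in># S - mset xs \<Longrightarrow>
      cost (xs @ [x]) - cost xs \<le> cost (xs @ [y]) - cost xs \<Longrightarrow>
      \<bar>sum_list (map g xs) + g x\<bar> \<le> \<bar>sum_list (map g xs) + g y\<bar>"
  shows "best_first_partial prefixsum_cost (image_mset g S) (map g xs)"
  using assms(1)
proof (induction rule: best_first_partial.induct)
  case empty
  show ?case by (simp add: best_first_partial.empty)
next
  case (extend xs x)
  have sub: "mset xs \<subseteq># S" using best_first_partial_subset_mset extend.hyps(1) .
  then have D: "image_mset g S - mset (map g xs) = image_mset g (S - mset xs)"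
    by (simp add: image_mset_Diff)
  have "best_first_partial prefixsum_cost (image_mset g S) (map g xs @ [g x])"
  proof (rule best_first_partial.extend[OF extend.IH])
    show "g x \<in># image_mset g S - mset (map g xs)"
      unfolding D using extend.hyps(2) by simp
    show "\<forall>y\<in>#image_mset g S - mset (map g xs).
       prefixsum_cost (map g xs @ [g x]) - prefixsum_cost (map g xs)
       \<le> prefixsum_cost (map g xs @ [y]) - prefixsum_cost (map g xs)"
      unfolding D using step[OF sub extend.hyps(2)] extend.hyps(3)
      by (auto simp: prefixsum_cost_snoc)
  qed
  then show ?case by simp
qed

section \<open>Both objectives for series with two time points\<close>

definition slope :: "(nat \<Rightarrow> real) \<Rightarrow> real" where
  "slope f = f 2 - f 1"

lemma W_eq_sum_slope:
  assumes "i < length xs"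
  shows "W xs i 1 = (\<Sum>k\<le>i. map slope xs ! k)"
  unfolding W_def using assms by (intro sum.cong) (auto simp: slope_def numeral_2_eq_2)

lemma wiggle_cost_two: "wiggle_cost 2 xs = prefixsum_cost (map slope xs)"
proof -
  have "{1..<2::nat} = {1}" by auto
  then show ?thesis
    unfolding wiggle_cost_def prefixsum_cost_def by (auto intro!: sum.cong simp: W_eq_sum_slope[simplified])
qed

lemma sum_nth_last:
  fixes xs :: "real list"
  assumes "Suc i = length xs"
  shows "(\<Sum>k\<le>i. xs ! k) = sum_list xs"
  using assms by (simp add: sum_list_sum_nth atLeast0LessThan lessThan_Suc_atMost flip: assms)

text \<open>Appending \<open>x\<close> affects two weights: at the formerly last position the
  successor changes from the zero series to \<open>x\<close>, and a new position arises whose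
  successor is the zero series. Both gain \<open>(x 1 + x 2) / 4\<close>, which multiplies the
  prefix sums before and after \<open>x\<close>.\<close>

lemma weighted_wiggle_cost_two_snoc:
  "weighted_wiggle_cost 2 (xs @ [x]) = weighted_wiggle_cost 2 xs +
     (x 1 + x 2) / 4 * (\<bar>sum_list (map slope xs)\<bar> + \<bar>sum_list (map slope xs) + slope x\<bar>)"
proof -
  have s: "{1..<2::nat} = {1}" by auto
  define t where "t \<rho> i = ((\<rho> ! i) 1 + (\<rho> ! i) (1 + 1) + (\<rho> ! Suc i) 1 + (\<rho> ! Suc i) (1 + 1)) / (4::real)"
    for \<rho> :: "(nat \<Rightarrow> real) list" and i
  let ?z = "\<lambda>_::nat. 0::real" and ?n = "length xs"
  let ?Q = "sum_list (map slope xs)"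
  have cost: "weighted_wiggle_cost 2 ys = (\<Sum>i<length ys. t (ys @ [?z]) i * \<bar>W ys i 1\<bar>)" for ys
    unfolding weighted_wiggle_cost_def Let_def s t_def by simp
  have W1: "W (xs @ [x]) i 1 = W xs i 1" if "i < ?n" for i
    unfolding W_def using that by (intro sum.cong) (auto simp: nth_append)
  have Wn: "W (xs @ [x]) ?n 1 = ?Q + slope x"
    using sum_nth_last[of ?n "map slope (xs @ [x])"] by (subst W_eq_sum_slope) auto
  have summand: "t ((xs @ [x]) @ [?z]) i * \<bar>W xs i 1\<bar> =
      t (xs @ [?z]) i * \<bar>W xs i 1\<bar> + (if Suc i = ?n then (x 1 + x 2) / 4 * \<bar>?Q\<bar> else 0)"
    if i: "i < ?n" for i
  proof (cases "Suc i = ?n")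
    case True
    have "W xs i 1 = ?Q"
      using sum_nth_last[of i "map slope xs"] True i by (subst W_eq_sum_slope) auto
    with True i show ?thesis
      by (simp add: t_def nth_append algebra_simps add_divide_distrib numeral_2_eq_2)
  next
    case False
    with i show ?thesis by (simp add: t_def nth_append)
  qed
  \<comment> \<open>For empty \<open>xs\<close> there is no earlier position, and \<open>?Q\<close>
    is 0 as well.\<close>
  have "(\<Sum>i<?n. if Suc i = ?n then (x 1 + x 2) / 4 * \<bar>?Q\<bar> else 0) = (x 1 + x 2) / 4 * \<bar>?Q\<bar>"
    by (cases ?n) auto
  moreover have "t ((xs @ [x]) @ [?z]) ?n = (x 1 + x 2) / 4"
    by (simp add: t_def nth_append numeral_2_eq_2)
  moreover have "(\<Sum>i<?n. t ((xs @ [x]) @ [?z]) i * \<bar>W (xs @ [x]) i 1\<bar>) =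
      (\<Sum>i<?n. t (xs @ [?z]) i * \<bar>W xs i 1\<bar> + (if Suc i = ?n then (x 1 + x 2) / 4 * \<bar>?Q\<bar> else 0))"
    by (intro sum.cong refl) (simp only: W1 summand lessThan_iff)
  ultimately show ?thesis
    unfolding cost length_append_singleton sum.lessThan_Suc Wn by (simp only: sum.distrib distrib_left add.assoc)
qed

text \<open>Each prefix sum is weighted by its own series and by the successor, which gives the
  factor \<open>hi / 2\<close>. The last one still lacks its successor; the extra term on the left
  of the upper bound reserves that share for the next induction step.\<close>

lemma weighted_wiggle_cost_two_bounds:
  assumes "\<forall>f\<in>set xs. lo \<le> f 1 + f 2 \<and> f 1 + f 2 \<le> hi" "0 \<le> lo"
  shows "lo / 4 * prefixsum_cost (map slope xs) \<le> weighted_wiggle_cost 2 xs \<and>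
    weighted_wiggle_cost 2 xs + hi / 4 * \<bar>sum_list (map slope xs)\<bar> \<le> hi / 2 * prefixsum_cost (map slope xs)"
  using assms(1)
proof (induction xs rule: rev_induct)
  case Nil
  then show ?case by (simp add: weighted_wiggle_cost_def)
next
  case (snoc x xs)
  let ?s = "x 1 + x 2" and ?P = "\<bar>sum_list (map slope xs)\<bar>"
    and ?Q = "\<bar>sum_list (map slope xs) + slope x\<bar>"
  have s: "lo \<le> ?s" "?s \<le> hi" using snoc.prems by auto
  have "lo / 4 * ?Q \<le> ?s / 4 * ?Q" using s by (intro mult_right_mono) auto
  also have "\<dots> \<le> ?s / 4 * (?P + ?Q)" using s assms(2) by (intro mult_left_mono) auto
  finally have a: "lo / 4 * ?Q \<le> ?s / 4 * (?P + ?Q)" .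
  have b: "?s / 4 * (?P + ?Q) \<le> hi / 4 * (?P + ?Q)" using s by (intro mult_right_mono) auto
  have IH: "lo / 4 * prefixsum_cost (map slope xs) \<le> weighted_wiggle_cost 2 xs"
    "weighted_wiggle_cost 2 xs + hi / 4 * ?P \<le> hi / 2 * prefixsum_cost (map slope xs)"
    using snoc by auto
  have "lo / 4 * (prefixsum_cost (map slope xs) + ?Q) \<le> weighted_wiggle_cost 2 xs + ?s / 4 * (?P + ?Q)"
    using add_mono[OF IH(1) a] by (simp only: distrib_left[of "lo / 4"])
  moreover have "weighted_wiggle_cost 2 xs + ?s / 4 * (?P + ?Q) + hi / 4 * ?Q
      \<le> hi / 2 * (prefixsum_cost (map slope xs) + ?Q)"
    using b IH(2) unfolding distrib_left[of "hi / 4"] distrib_left[of "hi / 2"] by linarith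
  ultimately show ?case
    by (simp only: map_append list.map sum_list_append sum_list_simps add_0_right
        prefixsum_cost_snoc weighted_wiggle_cost_two_snoc)
qed

text \<open>
  If the weights of all series nearly agree and the slopes are integers, then BestFirst for the
  weighted objective prefers a strictly smaller absolute prefix sum, which is smaller by at least 1.
\<close>
lemma weighted_wiggle_greedy_choice:
  assumes F: "\<forall>f\<in>insert x (insert y (set xs)). lo \<le> f 1 + f 2 \<and> f 1 + f 2 \<le> lo + \<Delta> \<and>
      slope f \<in> \<int> \<and> \<bar>slope f\<bar> \<le> m"
    and len: "length xs < n" and lo: "\<Delta> * (2 * m * real n) < lo"
    and le: "weighted_wiggle_cost 2 (xs @ [x]) \<le> weighted_wiggle_cost 2 (xs @ [y])"
  shows "\<bar>sum_list (map slope xs) + slope x\<bar> \<le> \<bar>sum_list (map slope xs) + slope y\<bar>"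
proof (rule ccontr)
  define P where "P = sum_list (map slope xs)"
  define X where "X = \<bar>P + slope x\<bar>"
  define Y where "Y = \<bar>P + slope y\<bar>"
  let ?sx = "x 1 + x 2" and ?sy = "y 1 + y 2"
  assume "\<not> \<bar>sum_list (map slope xs) + slope x\<bar> \<le> \<bar>sum_list (map slope xs) + slope y\<bar>"
  then have "Y < X" by (simp add: P_def X_def Y_def)
  have abs_P: "\<bar>P\<bar> \<le> real (length xs) * m" and Pint: "P \<in> \<int>"
    using F unfolding P_def
    by (induction xs) (auto simp: algebra_simps intro!: Ints_add)
  have "X \<in> \<int>" "Y \<in> \<int>" using Pint F by (auto simp: X_def Y_def)
  then obtain i j where ij: "X = of_int i" "Y = of_int j" by (auto elim!: Ints_cases)
  with \<open>Y < X\<close> have XY: "Y + 1 \<le> X" by simp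
  have \<Delta>: "0 \<le> \<Delta>" "0 \<le> m" using F by auto
  have "\<bar>P\<bar> + m \<le> real n * m"
  proof -
    have "real (length xs) * m + m = real (Suc (length xs)) * m" by (simp add: algebra_simps)
    also have "\<dots> \<le> real n * m" using len \<Delta> by (intro mult_right_mono) auto
    finally show ?thesis using abs_P by simp
  qed
  moreover have "X \<le> \<bar>P\<bar> + m" using F by (auto simp: X_def)
  ultimately have Q: "\<bar>P\<bar> + X \<le> 2 * m * real n" using \<Delta> by (simp add: algebra_simps)
  have nn: "0 \<le> X" "0 \<le> Y" by (auto simp: X_def Y_def)
  have "0 \<le> \<Delta> * (2 * m * real n)" using \<Delta> by simp
  then have lo0: "0 < lo" using lo by linarith
  \<comment> \<open>The increases caused by \<open>x\<close> and \<open>y\<close> are compared, with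
    weight at least \<open>lo\<close> for \<open>x\<close> and at most \<open>lo + \<Delta>\<close>
    for \<open>y\<close>. Since \<open>Y \<le> X - 1\<close>, only
    \<open>lo + \<Delta> \<le> \<Delta> * (\<bar>P\<bar> + X)\<close> remains, and \<open>lo\<close>
    is too large for that.\<close>
  have "lo * (\<bar>P\<bar> + X) \<le> ?sx * (\<bar>P\<bar> + X)" using F nn by (intro mult_right_mono) auto
  also have "\<dots> \<le> ?sy * (\<bar>P\<bar> + Y)"
    using le by (simp add: weighted_wiggle_cost_two_snoc P_def X_def Y_def)
  also have "\<dots> \<le> (lo + \<Delta>) * (\<bar>P\<bar> + Y)" using F nn by (intro mult_right_mono) auto
  also have "\<dots> \<le> (lo + \<Delta>) * (\<bar>P\<bar> + X - 1)" using XY lo0 \<Delta> by (intro mult_left_mono) auto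
  finally have "lo + \<Delta> \<le> \<Delta> * (\<bar>P\<bar> + X)" by (simp add: algebra_simps)
  also have "\<dots> \<le> \<Delta> * (2 * m * real n)" using Q \<Delta> by (intro mult_left_mono) auto
  finally show False using lo \<Delta> by simp
qed

section \<open>Sets of time series with prescribed slopes\<close>

lemma time_series_realization:
  fixes L :: "real list"
  assumes B: "\<forall>x\<in>set L. \<bar>x\<bar> \<le> B"
  obtains F where "finite F" "F \<subseteq> time_series 2" "card F = length L"
    "image_mset slope (mset_set F) = mset L"
    "\<And>f. f \<in> F \<Longrightarrow> 2 * B - \<bar>slope f\<bar> \<le> f 1 + f 2"
    "\<And>f. f \<in> F \<Longrightarrow> f 1 + f 2 \<le> 2 * B + 2 * real (length L) + \<bar>slope f\<bar>"
proof -
  \<comment> \<open>The offset \<open>B\<close> keeps the values nonnegative. The shift by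
    \<open>i\<close> makes the series distinct, so that equal numbers in \<open>L\<close> become
    different elements of a set. Neither changes the slope.\<close>
  define f where "f i = (\<lambda>j\<in>{1..2::nat}. B + real i + (if j = 2 then L ! i else 0))" for i
  have slope: "slope (f i) = L ! i" for i by (simp add: slope_def f_def)
  have inj: "inj_on f {..<length L}"
    by (rule inj_onI) (auto simp: f_def dest: fun_cong[where x = 1])
  have "image_mset slope (mset_set (f ` {..<length L})) = image_mset (\<lambda>i. L ! i) (mset_set {..<length L})"
    by (simp add: image_mset_mset_set[OF inj, symmetric] multiset.map_comp o_def slope)
  also have "\<dots> = mset L"
    by (metis atLeast0LessThan map_nth mset_map mset_upt)
  finally have im: "image_mset slope (mset_set (f ` {..<length L})) = mset L" .
  show ?thesis
  proof
    show "f ` {..<length L} \<subseteq> time_series 2"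
    proof safe
      fix i assume "i < length L"
      then have "\<bar>L ! i\<bar> \<le> B" using B by simp
      then show "f i \<in> time_series 2" by (auto simp: f_def time_series_def)
    qed
    show "card (f ` {..<length L}) = length L" by (simp add: card_image inj)
  qed (use im in \<open>auto simp: slope, auto simp: f_def\<close>)
qed

lemma wiggle_instance:
  assumes h: "h \<ge> 6"
  obtains F where "finite F" "F \<subseteq> time_series 2" "card F = 4 * h\<^sup>2 + 4 * h"
    "image_mset slope (mset_set F) = bad_instance h"
    "\<And>f. f \<in> F \<Longrightarrow> slope f \<in> \<int> \<and> \<bar>slope f\<bar> \<le> 2 * real h"
    "\<exists>lo \<Delta>. lo > 0 \<and> \<Delta> \<ge> 0 \<and> \<Delta> * (2 * (2 * real h) * real (card F)) < lo \<and>
      (\<forall>f\<in>F. lo \<le> f 1 + f 2 \<and> f 1 + f 2 \<le> lo + \<Delta>)"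
proof -
  obtain L where L: "mset L = bad_instance h" using ex_mset by blast
  have len: "length L = 4 * h\<^sup>2 + 4 * h" by (metis L size_mset size_bad_instance)
  \<comment> \<open>The spread of the weights: the shifts contribute \<open>2 * length L\<close>,
    and the slopes, bounded by \<open>2h\<close> in absolute value, contribute \<open>4h\<close>.
    Next, \<open>lo\<close> is chosen to satisfy the gap condition of
    \<open>weighted_wiggle_greedy_choice\<close> with \<open>m = 2h\<close>.\<close>
  define \<Delta> where "\<Delta> = 2 * real (length L) + 4 * real h"
  define lo where "lo = \<Delta> * (2 * (2 * real h) * real (length L)) + 1"
  have \<Delta>: "\<Delta> \<ge> 0" by (simp add: \<Delta>_def)
  have slack: "\<Delta> * (2 * (2 * real h) * real (length L)) < lo" by (simp add: lo_def)
  have lo: "lo \<ge> 1" using \<Delta> by (simp add: lo_def)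
  have LP: "x \<in> \<int> \<and> \<bar>x\<bar> \<le> 2 * real h" if "x \<in># bad_instance h" for x
    using bad_instance_memberD[OF that] h by auto
  \<comment> \<open>The offset \<open>lo / 2 + h\<close> makes every weight at least
    \<open>lo\<close> even for slope \<open>-2h\<close>; it must also bound the entries of
    \<open>L\<close>.\<close>
  have "\<bar>x\<bar> \<le> lo / 2 + real h" if "x \<in> set L" for x
  proof -
    have "1 \<le> length L" using h len by simp
    then have L1: "1 \<le> real (length L)" by linarith
    then have "1 \<le> \<Delta>" unfolding \<Delta>_def using h by linarith
    moreover have "real h * 1 \<le> real h * real (length L)" using L1 by (intro mult_left_mono) auto
    ultimately have "1 * (real h * 1) \<le> \<Delta> * (real h * real (length L))"
      by (rule mult_mono) (use \<Delta> in auto)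
    then have "2 * real h \<le> lo"
      unfolding lo_def by (simp add: algebra_simps)
    moreover have "x \<in># bad_instance h" using that unfolding L[symmetric] by simp
    then have "\<bar>x\<bar> \<le> 2 * real h" using LP by blast
    ultimately show ?thesis by linarith
  qed
  then obtain F where F: "finite F" "F \<subseteq> time_series 2" "card F = length L"
    "image_mset slope (mset_set F) = mset L"
    "\<And>f. f \<in> F \<Longrightarrow> 2 * (lo / 2 + real h) - \<bar>slope f\<bar> \<le> f 1 + f 2"
    "\<And>f. f \<in> F \<Longrightarrow> f 1 + f 2 \<le> 2 * (lo / 2 + real h) + 2 * real (length L) + \<bar>slope f\<bar>"
    using time_series_realization[of L] by (metis (no_types, lifting))
  have sl: "slope f \<in> \<int> \<and> \<bar>slope f\<bar> \<le> 2 * real h" if "f \<in> F" for f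
  proof (rule LP)
    have "slope f \<in># image_mset slope (mset_set F)" using that F(1) by simp
    then show "slope f \<in># bad_instance h" using F(4) L by simp
  qed
  show ?thesis
  proof (rule that[OF F(1,2)])
    have weights: "lo \<le> f 1 + f 2 \<and> f 1 + f 2 \<le> lo + \<Delta>" if "f \<in> F" for f
      using F(5,6)[OF that] sl[OF that] unfolding \<Delta>_def by auto
    show "\<exists>lo \<Delta>. lo > 0 \<and> \<Delta> \<ge> 0 \<and> \<Delta> * (2 * (2 * real h) * real (card F)) < lo \<and>
      (\<forall>f\<in>F. lo \<le> f 1 + f 2 \<and> f 1 + f 2 \<le> lo + \<Delta>)"
      by (rule exI[of _ lo], rule exI[of _ \<Delta>]) (use weights lo \<Delta> slack F(3) in auto)
  qed (use F L len sl in auto)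
qed

section \<open>The ratio for the three problems\<close>

lemma wiggle_best_first_ratio:
  assumes "N \<ge> 6"
  shows "\<exists>l F. finite F \<and> F \<subseteq> time_series l \<and> N \<le> card F \<and>
       0 < opt_value (wiggle_cost l) (mset_set F) \<and>
       (\<forall>\<pi>. best_first (wiggle_cost l) (mset_set F) \<pi> \<longrightarrow>
          wiggle_cost l \<pi> \<ge>
            1 / 34 * root 3 (real (card F)) * opt_value (wiggle_cost l) (mset_set F))"
proof -
  obtain F where F: "finite F" "F \<subseteq> time_series 2" "card F = 4 * N\<^sup>2 + 4 * N"
    "image_mset slope (mset_set F) = bad_instance N"
    using wiggle_instance[OF assms] by metis
  have greedy: "best_first_partial prefixsum_cost (bad_instance N) (map slope xs)"
    if "best_first_partial (wiggle_cost 2) (mset_set F) xs" for xs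
    using best_first_partial_map[OF that, of slope]
    by (simp add: F wiggle_cost_two prefixsum_cost_snoc)
  note ratio = best_first_ratio_transfer[of N slope "mset_set F" 1 "wiggle_cost 2",
      OF assms F(4) _ _ _ greedy]
  show ?thesis
    by (rule exI[of _ 2], rule exI[of _ F])
      (use F ratio prefixsum_cost_nonneg in \<open>auto simp: wiggle_cost_two\<close>)
qed

lemma weighted_wiggle_best_first_ratio:
  assumes "N \<ge> 6"
  shows "\<exists>l F. finite F \<and> F \<subseteq> time_series l \<and> N \<le> card F \<and>
       0 < opt_value (weighted_wiggle_cost l) (mset_set F) \<and>
       (\<forall>\<pi>. best_first (weighted_wiggle_cost l) (mset_set F) \<pi> \<longrightarrow>
          weighted_wiggle_cost l \<pi> \<ge>
            1 / 34 * root 3 (real (card F)) * opt_value (weighted_wiggle_cost l) (mset_set F))"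
proof -
  obtain F where F: "finite F" "F \<subseteq> time_series 2" "card F = 4 * N\<^sup>2 + 4 * N"
    "image_mset slope (mset_set F) = bad_instance N"
    "\<And>f. f \<in> F \<Longrightarrow> slope f \<in> \<int> \<and> \<bar>slope f\<bar> \<le> 2 * real N"
    "\<exists>lo \<Delta>. lo > 0 \<and> \<Delta> \<ge> 0 \<and> \<Delta> * (2 * (2 * real N) * real (card F)) < lo \<and>
      (\<forall>f\<in>F. lo \<le> f 1 + f 2 \<and> f 1 + f 2 \<le> lo + \<Delta>)"
    using wiggle_instance[OF assms] by metis
  then obtain lo \<Delta> where lo: "lo > 0" "\<Delta> \<ge> 0" "\<Delta> * (2 * (2 * real N) * real (card F)) < lo"
      "\<forall>f\<in>F. lo \<le> f 1 + f 2 \<and> f 1 + f 2 \<le> lo + \<Delta>" by blast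
  \<comment> \<open>The aim is \<open>\<Delta> \<le> lo\<close>: then all weights lie between
    \<open>lo\<close> and \<open>2 * lo\<close>, and the weighted cost lies between
    \<open>lo / 4\<close> and \<open>lo\<close> times the prefix sum cost, so
    \<open>\<alpha> = lo / 4\<close> fits the transfer.\<close>
  have "\<Delta> * 1 \<le> \<Delta> * (2 * (2 * real N) * real (card F))"
  proof (intro mult_left_mono lo(2))
    have "1 \<le> 2 * (2 * N) * card F" using F(3) assms by simp
    then have "real 1 \<le> real (2 * (2 * N) * card F)" by (simp only: of_nat_le_iff)
    then show "1 \<le> 2 * (2 * real N) * real (card F)" by simp
  qed
  then have \<Delta>: "\<Delta> \<le> lo" using lo(3) by linarith
  have greedy: "best_first_partial prefixsum_cost (bad_instance N) (map slope xs)"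
    if "best_first_partial (weighted_wiggle_cost 2) (mset_set F) xs" for xs
    unfolding F(4)[symmetric] using that
  proof (rule best_first_partial_map)
    fix ys x y
    assume ys: "mset ys \<subseteq># mset_set F" and x: "x \<in># mset_set F - mset ys"
      and y: "y \<in># mset_set F - mset ys"
      and le: "weighted_wiggle_cost 2 (ys @ [x]) - weighted_wiggle_cost 2 ys
        \<le> weighted_wiggle_cost 2 (ys @ [y]) - weighted_wiggle_cost 2 ys"
    have "insert x (insert y (set ys)) \<subseteq> F"
      using x y set_mset_mono[OF ys] F(1) by (auto dest: in_diffD)
    moreover have "length ys < card F"
    proof -
      have "size (mset ys) \<le> size (mset_set F)" using ys by (rule size_mset_mono)
      moreover have "size (mset_set F - mset ys) \<noteq> 0" using x by auto
      ultimately show ?thesis using ys by (simp add: size_Diff_submset)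
    qed
    ultimately show "\<bar>sum_list (map slope ys) + slope x\<bar> \<le> \<bar>sum_list (map slope ys) + slope y\<bar>"
      using lo F(5) le
      by (intro weighted_wiggle_greedy_choice[where m = "2 * real N" and n = "card F"
            and lo = lo and \<Delta> = \<Delta>]) auto
  qed
  have bounds: "lo / 4 * prefixsum_cost (map slope xs) \<le> weighted_wiggle_cost 2 xs"
    "weighted_wiggle_cost 2 xs \<le> 4 * (lo / 4) * prefixsum_cost (map slope xs)"
    if "mset xs = mset_set F" for xs
  proof -
    have "set xs = F" using that F(1) by (metis finite_set_mset_mset_set set_mset_mset)
    then have "\<forall>f\<in>set xs. lo \<le> f 1 + f 2 \<and> f 1 + f 2 \<le> 2 * lo" using lo(4) \<Delta> by fastforce
    from weighted_wiggle_cost_two_bounds[OF this] lo(1)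
    have "lo / 4 * prefixsum_cost (map slope xs) \<le> weighted_wiggle_cost 2 xs"
      and *: "weighted_wiggle_cost 2 xs + 2 * lo / 4 * \<bar>sum_list (map slope xs)\<bar>
        \<le> 2 * lo / 2 * prefixsum_cost (map slope xs)" by auto
    moreover have "0 \<le> 2 * lo / 4 * \<bar>sum_list (map slope xs)\<bar>" using lo(1) by simp
    ultimately show "lo / 4 * prefixsum_cost (map slope xs) \<le> weighted_wiggle_cost 2 xs"
      "weighted_wiggle_cost 2 xs \<le> 4 * (lo / 4) * prefixsum_cost (map slope xs)" by auto
  qed
  have "lo / 4 > 0" using lo(1) by simp
  note ratio = best_first_ratio_transfer[of N slope "mset_set F" "lo / 4" "weighted_wiggle_cost 2",
      OF assms F(4) this bounds greedy]
  show ?thesis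
    by (rule exI[of _ 2], rule exI[of _ F]) (use F ratio in auto)
qed

lemma prefixsum_best_first_ratio:
  assumes "N \<ge> 6"
  shows "\<exists>S. N \<le> size S \<and> 0 < opt_value prefixsum_cost S \<and>
       (\<forall>\<pi>. best_first prefixsum_cost S \<pi> \<longrightarrow>
          prefixsum_cost \<pi> \<ge> 1 / 34 * root 3 (real (size S)) * opt_value prefixsum_cost S)"
proof -
  note ratio = best_first_ratio_transfer[of N "\<lambda>x. x" "bad_instance N" 1 prefixsum_cost, OF assms]
  show ?thesis
    by (rule exI[of _ "bad_instance N"])
      (use ratio prefixsum_cost_nonneg in \<open>auto simp: size_bad_instance\<close>)
qed

theorem theorem17:
  "(\<exists>c>0. \<forall>N. \<exists>l F. finite F \<and> F \<subseteq> time_series l \<and> N \<le> card F \<and>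
       0 < opt_value (weighted_wiggle_cost l) (mset_set F) \<and>
       (\<forall>\<pi>. best_first (weighted_wiggle_cost l) (mset_set F) \<pi> \<longrightarrow>
          weighted_wiggle_cost l \<pi> \<ge>
            c * root 3 (real (card F)) * opt_value (weighted_wiggle_cost l) (mset_set F))) \<and>
   (\<exists>c>0. \<forall>N. \<exists>l F. finite F \<and> F \<subseteq> time_series l \<and> N \<le> card F \<and>
       0 < opt_value (wiggle_cost l) (mset_set F) \<and>
       (\<forall>\<pi>. best_first (wiggle_cost l) (mset_set F) \<pi> \<longrightarrow>
          wiggle_cost l \<pi> \<ge>
            c * root 3 (real (card F)) * opt_value (wiggle_cost l) (mset_set F))) \<and>
   (\<exists>c>0. \<forall>N. \<exists>S. N \<le> size S \<and>
       0 < opt_value prefixsum_cost S \<and>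
       (\<forall>\<pi>. best_first prefixsum_cost S \<pi> \<longrightarrow>
          prefixsum_cost \<pi> \<ge> c * root 3 (real (size S)) * opt_value prefixsum_cost S))"
proof (intro conjI; intro exI[of _ "1 / 34"] conjI allI)
  fix N :: nat
  \<comment> \<open>The shift by 6 meets the condition \<open>h \<ge> 6\<close>; the instance is
    then larger than \<open>N\<close> requires.\<close>
  have N: "6 \<le> N + 6" "N \<le> N + 6" by auto
  show "\<exists>l F. finite F \<and> F \<subseteq> time_series l \<and> N \<le> card F \<and>
       0 < opt_value (weighted_wiggle_cost l) (mset_set F) \<and>
       (\<forall>\<pi>. best_first (weighted_wiggle_cost l) (mset_set F) \<pi> \<longrightarrow>
          weighted_wiggle_cost l \<pi> \<ge>
            1 / 34 * root 3 (real (card F)) * opt_value (weighted_wiggle_cost l) (mset_set F))"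
    using weighted_wiggle_best_first_ratio[OF N(1)] N(2) by (meson order_trans)
  show "\<exists>l F. finite F \<and> F \<subseteq> time_series l \<and> N \<le> card F \<and>
       0 < opt_value (wiggle_cost l) (mset_set F) \<and>
       (\<forall>\<pi>. best_first (wiggle_cost l) (mset_set F) \<pi> \<longrightarrow>
          wiggle_cost l \<pi> \<ge>
            1 / 34 * root 3 (real (card F)) * opt_value (wiggle_cost l) (mset_set F))"
    using wiggle_best_first_ratio[OF N(1)] N(2) by (meson order_trans)
  show "\<exists>S. N \<le> size S \<and> 0 < opt_value prefixsum_cost S \<and>
       (\<forall>\<pi>. best_first prefixsum_cost S \<pi> \<longrightarrow>
          prefixsum_cost \<pi> \<ge> 1 / 34 * root 3 (real (size S)) * opt_value prefixsum_cost S)"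
    using prefixsum_best_first_ratio[OF N(1)] N(2) by (meson order_trans)
qed simp_all

end
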